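(* Let $i\in N_4=\{1,2,3,4\}$, let $\mathbf r$ be the rank function of $\hat U^i_{3,5}$, and let $a\ge 0$ be a real number. Then $\mathbf h=a\mathbf r$ is entropic if and only if $a=\log v$ for some integer $v\ge 1$.
   Context: $N_4=\{1,2,3,4\}$. A set function $\mathbf h:2^{N_4}\to\mathbb R$ is called entropic if there is a random vector $(X_1,X_2,X_3,X_4)$, each $X_i$ taking values in a finite set, with $\mathbf h(A)=H(X_A)$ for all $A\subseteq N_4$, where $H$ is Shannon entropy, $X_A=(X_j,j\in A)$ and $\mathbf h(\emptyset)=0$. Logarithms (also in the entropy) are to base $2$. For $i\in N_4$, $\hat U^i_{3,5}$ is the integer polymatroid on $N_4$ with rank function $\mathbf r(A)=\min\{3,|A|+1\}$ if $i\in A$ and $\mathbf r(A)=|A|$ if $i\notin A$. *)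

theory Defs
  imports "HOL-Probability.Probability"
begin

definition N4 :: "nat set" where
  "N4 = {1, 2, 3, 4}"

text \<open>Shannon entropy to base 2 of the subvector indexed by \<open>A\<close>. The subvector is the tuple
  of the \<open>X j\<close>, \<open>j \<in> A\<close>, as an extensional function on \<open>A\<close>; for empty \<open>A\<close> it is constant.\<close>

definition subvector :: "(nat \<Rightarrow> 'w \<Rightarrow> 'v) \<Rightarrow> nat set \<Rightarrow> 'w \<Rightarrow> (nat \<Rightarrow> 'v)" where
  "subvector X A = (\<lambda>\<omega>. \<lambda>j\<in>A. X j \<omega>)"

definition shannon_entropy :: "'w measure \<Rightarrow> ('w \<Rightarrow> 'b) \<Rightarrow> real" where
  "shannon_entropy M Y = prob_space.entropy M 2 (count_space (Y ` space M)) Y"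

definition has_entropy_function ::
  "'w measure \<Rightarrow> (nat \<Rightarrow> 'w \<Rightarrow> 'v) \<Rightarrow> (nat set \<Rightarrow> real) \<Rightarrow> bool" where
  "has_entropy_function M X h \<longleftrightarrow>
     prob_space M \<and>
     (\<forall>j\<in>N4. simple_function M (X j)) \<and>
     (\<forall>A. A \<subseteq> N4 \<longrightarrow> h A = shannon_entropy M (subvector X A))"

text \<open>HOL cannot quantify over types inside a definition, so the sample space and the alphabets
  are taken in \<open>nat\<close>. This is no restriction, see \<open>has_entropy_function_imp_entropic\<close>.\<close>

definition entropic :: "(nat set \<Rightarrow> real) \<Rightarrow> bool" where
  "entropic h \<longleftrightarrow>
     (\<exists>(M :: nat measure) (X :: nat \<Rightarrow> nat \<Rightarrow> nat). has_entropy_function M X h)"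

definition rank_U35 :: "nat \<Rightarrow> nat set \<Rightarrow> nat" where
  "rank_U35 i A = (if i \<in> A then min 3 (card A + 1) else card A)"

lemma shannon_entropy_simple:
  assumes "prob_space M" "simple_function M Y"
  shows "shannon_entropy M Y =
    - (\<Sum>y\<in>Y ` space M. measure M (Y -` {y} \<inter> space M) * log 2 (measure M (Y -` {y} \<inter> space M)))"
proof -
  interpret prob_space M by fact
  interpret information_space M 2 by unfold_locales simp
  have "simple_distributed M Y (\<lambda>y. measure M (Y -` {y} \<inter> space M))"
    using assms(2) by (intro simple_distributedI) (auto simp: measure_nonneg)
  from entropy_simple_distributed[OF this] show ?thesis
    unfolding shannon_entropy_def .
qed

lemma simple_function_subvector:
  assumes "\<forall>j\<in>N4. simple_function M (X j)" "A \<subseteq> N4"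
  shows "simple_function M (subvector X A)"
proof -
  have fA: "finite A" using assms(2) by (rule finite_subset) (simp add: N4_def)
  have "subvector X A ` space M \<subseteq> (\<Pi>\<^sub>E j\<in>A. X j ` space M)"
    by (auto simp: subvector_def)
  moreover have "finite (\<Pi>\<^sub>E j\<in>A. X j ` space M)"
    using assms fA by (intro finite_PiE) (auto simp: simple_function_def)
  ultimately have 1: "finite (subvector X A ` space M)" by (rule finite_subset)
  have 2: "subvector X A -` {y} \<inter> space M \<in> sets M" if "y \<in> subvector X A ` space M" for y
  proof -
    have "y \<in> extensional A" using that by (auto simp: subvector_def)
    then have "subvector X A -` {y} \<inter> space M = {\<omega> \<in> space M. \<forall>j\<in>A. X j \<omega> = y j}"
      by (auto simp: subvector_def fun_eq_iff extensional_def restrict_def)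
    also have "\<dots> \<in> sets M"
    proof (rule sets.sets_Collect_finite_All[OF _ fA])
      fix j assume "j \<in> A"
      then have "simple_function M (X j)" using assms by blast
      then have "X j -` {y j} \<inter> space M \<in> sets M" by (rule simple_functionD(2))
      then show "{\<omega> \<in> space M. X j \<omega> = y j} \<in> sets M"
        by (simp add: vimage_def Int_def conj_commute)
    qed
    finally show ?thesis .
  qed
  show ?thesis using 1 2 by (simp add: simple_function_def)
qed

lemma has_entropy_function_imp_entropic:
  fixes M :: "'w measure" and X :: "nat \<Rightarrow> 'w \<Rightarrow> 'v"
  assumes "has_entropy_function M X h"
  shows "entropic h"
proof -
  interpret prob_space M using assms by (simp add: has_entropy_function_def)
  have X: "\<forall>j\<in>N4. simple_function M (X j)"
    using assms by (simp add: has_entropy_function_def)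
  define Z where "Z = subvector X N4"
  have Z: "simple_function M Z" unfolding Z_def by (rule simple_function_subvector[OF X]) simp
  define V where "V = (\<Union>j\<in>N4. X j ` space M)"
  have finV: "finite V" using X by (auto simp: V_def simple_function_def N4_def)
  obtain g :: "'v \<Rightarrow> nat" where g: "inj_on g V"
    using finite_imp_inj_to_nat_seg[OF finV] by auto
  have finZ: "finite (Z ` space M)" using Z by (simp add: simple_function_def)
  obtain f :: "(nat \<Rightarrow> 'v) \<Rightarrow> nat" where f: "inj_on f (Z ` space M)"
    using finite_imp_inj_to_nat_seg[OF finZ] by auto
  define E where "E = (\<lambda>\<omega>. f (Z \<omega>))"
  have E: "simple_function M E"
    unfolding E_def using simple_function_compose1[OF Z] .
  have finE: "finite (E ` space M)" using E by (simp add: simple_function_def)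
  have mE: "E \<in> M \<rightarrow>\<^sub>M count_space (E ` space M)"
    using E by (auto simp: measurable_count_space_eq2[OF finE] simple_function_def)
  define N where "N = distr M (count_space (E ` space M)) E"
  have pN: "prob_space N" unfolding N_def by (rule prob_space_distr[OF mE])
  have spN: "space N = E ` space M" and setsN: "sets N = Pow (E ` space M)"
    by (simp_all add: N_def)
  define Y where "Y = (\<lambda>j n. g (inv_into (Z ` space M) f n j))"
  have YE: "Y j (E \<omega>) = g (X j \<omega>)" if "\<omega> \<in> space M" "j \<in> N4" for j \<omega>
    using that f by (simp add: Y_def E_def Z_def subvector_def)
  have Y: "\<forall>j\<in>N4. simple_function N (Y j)"
    by (auto simp: simple_function_def spN setsN finE)
  have "h A = shannon_entropy N (subvector Y A)" if A: "A \<subseteq> N4" for A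
  proof -
    define G where "G = (\<lambda>x. \<lambda>j\<in>A. g (x j :: 'v))"
    let ?XA = "subvector X A" and ?YA = "subvector Y A"
    have YG: "?YA (E \<omega>) = G (?XA \<omega>)" if "\<omega> \<in> space M" for \<omega>
      using that A YE by (auto simp: subvector_def G_def fun_eq_iff restrict_def)
    have inj: "inj_on G (?XA ` space M)"
    proof (rule inj_onI, clarify)
      fix w w' assume w: "w \<in> space M" "w' \<in> space M" "G (?XA w) = G (?XA w')"
      have "X j w = X j w'" if j: "j \<in> A" for j
      proof -
        have "g (X j w) = g (X j w')"
          using fun_cong[OF w(3), of j] j by (simp add: G_def subvector_def)
        moreover have "X j w \<in> V" "X j w' \<in> V" using w j A by (auto simp: V_def)
        ultimately show ?thesis using g by (simp add: inj_on_eq_iff)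
      qed
      then show "?XA w = ?XA w'" by (auto simp: subvector_def)
    qed
    have im: "?YA ` space N = G ` (?XA ` space M)"
      by (simp add: spN image_image YG cong: image_cong)
    have m: "measure N (?YA -` {G x} \<inter> space N) = measure M (?XA -` {x} \<inter> space M)"
      if "x \<in> ?XA ` space M" for x
    proof -
      have "measure N (?YA -` {G x} \<inter> space N) = measure M (E -` (?YA -` {G x} \<inter> space N) \<inter> space M)"
        unfolding N_def by (subst measure_distr[OF mE]) auto
      also have "E -` (?YA -` {G x} \<inter> space N) \<inter> space M = ?XA -` {x} \<inter> space M"
      proof -
        have "E \<omega> \<in> ?YA -` {G x} \<inter> space N \<longleftrightarrow> ?XA \<omega> = x" if \<omega>: "\<omega> \<in> space M" for \<omega>
        proof -
          have "E \<omega> \<in> space N" using \<omega> by (simp add: spN)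
          moreover have "G (?XA \<omega>) = G x \<longleftrightarrow> ?XA \<omega> = x"
            using inj \<omega> \<open>x \<in> ?XA ` space M\<close> by (intro inj_on_eq_iff) auto
          ultimately show ?thesis by (simp add: YG[OF \<omega>])
        qed
        then show ?thesis by blast
      qed
      finally show ?thesis .
    qed
    have "h A = shannon_entropy M ?XA"
      using assms A by (simp add: has_entropy_function_def)
    also have "\<dots> = shannon_entropy N ?YA"
      by (simp add: shannon_entropy_simple[OF prob_space_axioms simple_function_subvector[OF X A]]
          shannon_entropy_simple[OF pN simple_function_subvector[OF Y A]] im
          sum.reindex[OF inj] m)
    finally show ?thesis .
  qed
  with pN Y have "has_entropy_function N Y h" by (simp add: has_entropy_function_def)
  then show ?thesis unfolding entropic_def by blast
qed

end

theory Submission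
  imports Defs
begin

text \<open>Write \<open>q\<^sub>A\<close> for the probability of the value taken by \<open>X\<^sub>A\<close>. If \<open>j \<noteq> k\<close> are different from \<open>i\<close>,
  then each of \<open>X\<^sub>i\<^sub>j\<close> and \<open>X\<^sub>i\<^sub>k\<close> determines all variables, and \<open>X\<^sub>i\<close> is independent of \<open>X\<^sub>j\<close> and of \<open>X\<^sub>k\<close>;
  hence \<open>q\<^sub>i q\<^sub>j = q\<^sub>i q\<^sub>k\<close> and so \<open>q\<^sub>j = q\<^sub>k\<close> at every outcome of positive probability. Since \<open>X\<^sub>j\<close> and
  \<open>X\<^sub>k\<close> are independent, all pairs of their values occur together, so \<open>X\<^sub>j\<close> is uniform on
  its support and \<open>a\<close> is the logarithm of the size of the support.
  Conversely, take independent uniform elements of \<open>\<int>/v\<close> as the three variables other than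
  \<open>X\<^sub>i\<close>, and let \<open>X\<^sub>i\<close> consist of their differences.\<close>

section \<open>Point probabilities and entropy of simple random variables\<close>

definition point_prob :: "'w measure \<Rightarrow> ('w \<Rightarrow> 'b) \<Rightarrow> 'b \<Rightarrow> real" where
  "point_prob M Y y = measure M (Y -` {y} \<inter> space M)"

lemma point_prob_nonneg [simp]: "0 \<le> point_prob M Y y"
  by (simp add: point_prob_def)

lemma simple_function_Pair:
  assumes "simple_function M U" "simple_function M V"
  shows "simple_function M (\<lambda>\<omega>. (U \<omega>, V \<omega>))"
  using simple_function_compose2[OF assms, of Pair] by simp

context prob_space
begin

lemma sum_point_prob_Pair:
  assumes U: "simple_function M U" and V: "simple_function M V"
  shows "(\<Sum>v\<in>V ` space M. point_prob M (\<lambda>\<omega>. (U \<omega>, V \<omega>)) (u, v)) = point_prob M U u"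
proof -
  let ?F = "\<lambda>v. (\<lambda>\<omega>. (U \<omega>, V \<omega>)) -` {(u, v)} \<inter> space M"
  have "measure M (\<Union>v\<in>V ` space M. ?F v) = (\<Sum>v\<in>V ` space M. measure M (?F v))"
  proof (rule finite_measure_finite_Union)
    show "finite (V ` space M)" using V by (simp add: simple_function_def)
    show "?F ` (V ` space M) \<subseteq> sets M"
      using simple_functionD(2)[OF simple_function_Pair[OF U V]] by blast
    show "disjoint_family_on ?F (V ` space M)" by (auto simp: disjoint_family_on_def)
  qed
  moreover have "(\<Union>v\<in>V ` space M. ?F v) = U -` {u} \<inter> space M" by auto
  ultimately show ?thesis by (simp add: point_prob_def)
qed

lemma point_prob_Pair_swap:
  "point_prob M (\<lambda>\<omega>. (U \<omega>, V \<omega>)) (u, v) = point_prob M (\<lambda>\<omega>. (V \<omega>, U \<omega>)) (v, u)"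
  unfolding point_prob_def by (rule arg_cong[of _ _ "measure M"]) auto

lemma point_prob_Pair_le:
  assumes "simple_function M U"
  shows "point_prob M (\<lambda>\<omega>. (U \<omega>, V \<omega>)) (u, v) \<le> point_prob M U u"
  unfolding point_prob_def
  by (rule finite_measure_mono) (use simple_functionD(2)[OF assms] in auto)

lemma sum_point_prob:
  assumes "simple_function M U"
  shows "(\<Sum>u\<in>U ` space M. point_prob M U u) = 1"
proof -
  have "measure M (\<Union>u\<in>U ` space M. U -` {u} \<inter> space M) = (\<Sum>u\<in>U ` space M. point_prob M U u)"
    unfolding point_prob_def
  proof (rule finite_measure_finite_Union)
    show "finite (U ` space M)" using assms by (simp add: simple_function_def)
    show "(\<lambda>u. U -` {u} \<inter> space M) ` (U ` space M) \<subseteq> sets M"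
      using simple_functionD(2)[OF assms] by blast
  qed (auto simp: disjoint_family_on_def)
  moreover have "(\<Union>u\<in>U ` space M. U -` {u} \<inter> space M) = space M" by auto
  ultimately show ?thesis by (simp add: prob_space)
qed

lemma shannon_entropy_point_prob:
  assumes "simple_function M U"
  shows "shannon_entropy M U = - (\<Sum>u\<in>U ` space M. point_prob M U u * log 2 (point_prob M U u))"
  using shannon_entropy_simple[OF prob_space_axioms assms] by (simp add: point_prob_def)

text \<open>Null values in the range contribute nothing, and the remaining weights sum to 1. The
  range may contain null values because \<open>space M\<close> may contain null outcomes, so the
  condition on \<open>c\<close> excepts them.\<close>

lemma shannon_entropy_constant_point_prob:
  assumes U: "simple_function M U"
    and c: "\<And>u. u \<in> U ` space M \<Longrightarrow> point_prob M U u \<noteq> 0 \<Longrightarrow> point_prob M U u = c"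
  shows "shannon_entropy M U = - log 2 c"
proof -
  have "(\<Sum>u\<in>U ` space M. point_prob M U u * log 2 (point_prob M U u))
      = (\<Sum>u\<in>U ` space M. point_prob M U u * log 2 c)"
    by (rule sum.cong) (use c in force)+
  also have "\<dots> = log 2 c"
    by (simp add: sum_point_prob[OF U] flip: sum_distrib_right)
  finally show ?thesis by (simp add: shannon_entropy_point_prob[OF U])
qed

lemma shannon_entropy_inj:
  assumes U: "simple_function M U" and f: "inj_on f (U ` space M)"
  shows "shannon_entropy M (\<lambda>\<omega>. f (U \<omega>)) = shannon_entropy M U"
proof -
  have m: "point_prob M (\<lambda>\<omega>. f (U \<omega>)) (f u) = point_prob M U u" if "u \<in> U ` space M" for u
    unfolding point_prob_def using that f
    by (intro arg_cong[of _ _ "measure M"]) (auto simp: inj_on_def)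
  have im: "(\<lambda>\<omega>. f (U \<omega>)) ` space M = f ` U ` space M" by auto
  show ?thesis
    unfolding shannon_entropy_point_prob[OF U]
      shannon_entropy_point_prob[OF simple_function_compose1[OF U, of f]] im
    by (simp add: sum.reindex[OF f] m)
qed

text \<open>The joint range may be smaller than the product of the two ranges. The added pairs have
  an empty fibre, so their terms vanish; a sum over the product can then be compared with marginal
  sums.\<close>

lemma shannon_entropy_Pair:
  assumes U: "simple_function M U" and V: "simple_function M V"
  shows "shannon_entropy M (\<lambda>\<omega>. (U \<omega>, V \<omega>)) =
    - (\<Sum>u\<in>U ` space M. \<Sum>v\<in>V ` space M. point_prob M (\<lambda>\<omega>. (U \<omega>, V \<omega>)) (u, v)
        * log 2 (point_prob M (\<lambda>\<omega>. (U \<omega>, V \<omega>)) (u, v)))"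
proof -
  let ?p = "point_prob M (\<lambda>\<omega>. (U \<omega>, V \<omega>))"
  have fin: "finite (U ` space M)" "finite (V ` space M)"
    using U V by (simp_all add: simple_function_def)
  have "(\<Sum>w\<in>(\<lambda>\<omega>. (U \<omega>, V \<omega>)) ` space M. ?p w * log 2 (?p w))
      = (\<Sum>w\<in>U ` space M \<times> V ` space M. ?p w * log 2 (?p w))"
  proof (rule sum.mono_neutral_left)
    show "\<forall>w\<in>U ` space M \<times> V ` space M - (\<lambda>\<omega>. (U \<omega>, V \<omega>)) ` space M. ?p w * log 2 (?p w) = 0"
    proof
      fix w assume w: "w \<in> U ` space M \<times> V ` space M - (\<lambda>\<omega>. (U \<omega>, V \<omega>)) ` space M"
      have "(\<lambda>\<omega>. (U \<omega>, V \<omega>)) -` {w} \<inter> space M = {}" using w by blast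
      then show "?p w * log 2 (?p w) = 0" by (simp add: point_prob_def)
    qed
  qed (use fin in auto)
  then show ?thesis
    by (simp add: shannon_entropy_point_prob[OF simple_function_Pair[OF U V]] sum.cartesian_product)
qed

text \<open>This is the equality case of H(U) \<le> H(U,V). The difference is the sum of the terms
  \<open>t u v\<close>, each nonnegative because a joint probability is at most its marginal; a zero
  sum forces every term to vanish.\<close>

lemma point_prob_Pair_determined:
  assumes U: "simple_function M U" and V: "simple_function M V"
    and H: "shannon_entropy M (\<lambda>\<omega>. (U \<omega>, V \<omega>)) = shannon_entropy M U"
    and uv: "u \<in> U ` space M" "v \<in> V ` space M"
    and pos: "point_prob M (\<lambda>\<omega>. (U \<omega>, V \<omega>)) (u, v) \<noteq> 0"
  shows "point_prob M (\<lambda>\<omega>. (U \<omega>, V \<omega>)) (u, v) = point_prob M U u"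
proof -
  let ?p = "\<lambda>u v. point_prob M (\<lambda>\<omega>. (U \<omega>, V \<omega>)) (u, v)" and ?q = "point_prob M U"
  define t where "t u v = ?p u v * (log 2 (?q u) - log 2 (?p u v))" for u v
  have fin: "finite (U ` space M)" "finite (V ` space M)"
    using U V by (simp_all add: simple_function_def)
  have t: "0 \<le> t u v" for u v
  proof (cases "?p u v = 0")
    case False
    then have "0 < ?p u v" using point_prob_nonneg by (metis less_le)
    then show ?thesis
      using point_prob_Pair_le[OF U, of V u v] by (simp add: t_def)
  qed (simp add: t_def)
  have "(\<Sum>u\<in>U ` space M. ?q u * log 2 (?q u))
      = (\<Sum>u\<in>U ` space M. \<Sum>v\<in>V ` space M. ?p u v * log 2 (?q u))"
    by (simp add: sum_point_prob_Pair[OF U V] flip: sum_distrib_right)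
  then have "(\<Sum>u\<in>U ` space M. \<Sum>v\<in>V ` space M. t u v) = 0"
    using H by (simp add: shannon_entropy_Pair[OF U V] shannon_entropy_point_prob[OF U]
        t_def right_diff_distrib sum_subtractf)
  then have "t u v = 0"
    using fin uv t by (auto simp: sum_nonneg_eq_0_iff sum_nonneg)
  then have "log 2 (?q u) = log 2 (?p u v)" using pos by (simp add: t_def)
  moreover have "0 < ?p u v" using pos point_prob_nonneg by (metis less_le)
  moreover have "0 < ?q u" using calculation(2) point_prob_Pair_le[OF U, of V u v] by linarith
  ultimately show ?thesis by (simp add: log_def)
qed

text \<open>H(U) + H(V) - H(U,V) is the relative entropy between the joint law and the product of
  the marginals. The claim is the equality case of Gibbs' inequality, obtained from the equality
  case of \<open>ln x \<le> x - 1\<close>.\<close>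

lemma point_prob_Pair_indep:
  assumes U: "simple_function M U" and V: "simple_function M V"
    and H: "shannon_entropy M (\<lambda>\<omega>. (U \<omega>, V \<omega>)) = shannon_entropy M U + shannon_entropy M V"
    and uv: "u \<in> U ` space M" "v \<in> V ` space M"
  shows "point_prob M (\<lambda>\<omega>. (U \<omega>, V \<omega>)) (u, v) = point_prob M U u * point_prob M V v"
proof -
  let ?p = "\<lambda>u v. point_prob M (\<lambda>\<omega>. (U \<omega>, V \<omega>)) (u, v)"
    and ?q = "point_prob M U" and ?r = "point_prob M V"
  define t where "t u v = ?q u * ?r v - ?p u v
    - ln 2 * (?p u v * log 2 (?q u) + ?p u v * log 2 (?r v) - ?p u v * log 2 (?p u v))" for u v
  have fin: "finite (U ` space M)" "finite (V ` space M)"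
    using U V by (simp_all add: simple_function_def)
  \<comment> \<open>With \<open>x = q u * r v / p u v\<close>, the summand \<open>t u v\<close> is \<open>p u v * (x - 1 - ln x)\<close>.\<close>
  have t: "0 \<le> t u v \<and> (t u v = 0 \<longrightarrow> ?p u v = ?q u * ?r v)" for u v
  proof (cases "?p u v = 0")
    case False
    then have p: "0 < ?p u v" using point_prob_nonneg by (metis less_le)
    have q: "0 < ?q u" using p point_prob_Pair_le[OF U, of V u v] by linarith
    have r: "0 < ?r v"
      using p point_prob_Pair_le[OF V, of U v u] point_prob_Pair_swap[of U V u v] by linarith
    define x where "x = ?q u * ?r v / ?p u v"
    have x: "0 < x" using p q r by (simp add: x_def)
    have "ln x = ln (?q u) + ln (?r v) - ln (?p u v)"
      using p q r by (simp add: x_def ln_div ln_mult)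
    moreover have "ln 2 * log 2 y = ln y" for y :: real by (simp add: log_def)
    moreover have "t u v = ?q u * ?r v - ?p u v
        - ?p u v * (ln 2 * log 2 (?q u) + ln 2 * log 2 (?r v) - ln 2 * log 2 (?p u v))"
      by (simp add: t_def algebra_simps)
    ultimately have "t u v = ?q u * ?r v - ?p u v - ?p u v * ln x" by simp
    then have "t u v = ?p u v * (x - 1 - ln x)"
      using p by (simp add: x_def right_diff_distrib)
    moreover have "ln x \<le> x - 1" using x by (rule ln_le_minus_one)
    moreover have "x = 1" if "ln x = x - 1" using x that by (rule ln_eq_minus_one)
    ultimately show ?thesis using p by (auto simp: x_def)
  qed (simp add: t_def)
  have q: "(\<Sum>u\<in>U ` space M. \<Sum>v\<in>V ` space M. ?p u v * log 2 (?q u))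
      = (\<Sum>u\<in>U ` space M. ?q u * log 2 (?q u))"
    by (simp add: sum_point_prob_Pair[OF U V] flip: sum_distrib_right)
  \<comment> \<open>Swapping the roles of \<open>U\<close> and \<open>V\<close> makes the marginal
    formula applicable to the second coordinate.\<close>
  have "(\<Sum>u\<in>U ` space M. \<Sum>v\<in>V ` space M. ?p u v * log 2 (?r v))
      = (\<Sum>v\<in>V ` space M. \<Sum>u\<in>U ` space M. point_prob M (\<lambda>\<omega>. (V \<omega>, U \<omega>)) (v, u) * log 2 (?r v))"
    by (subst sum.swap) (simp add: point_prob_Pair_swap[of U V])
  then have r: "(\<Sum>u\<in>U ` space M. \<Sum>v\<in>V ` space M. ?p u v * log 2 (?r v))
      = (\<Sum>v\<in>V ` space M. ?r v * log 2 (?r v))"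
    by (simp add: sum_point_prob_Pair[OF V U] flip: sum_distrib_right)
  have p1: "(\<Sum>u\<in>U ` space M. \<Sum>v\<in>V ` space M. ?p u v) = 1"
    by (simp add: sum_point_prob_Pair[OF U V] sum_point_prob[OF U])
  have qr1: "(\<Sum>u\<in>U ` space M. \<Sum>v\<in>V ` space M. ?q u * ?r v) = 1"
    by (simp add: sum_point_prob[OF U] sum_point_prob[OF V] flip: sum_product)
  \<comment> \<open>The first two parts of \<open>t\<close> sum to 1 - 1, and the bracket sums to
    H(U,V) - H(U) - H(V), which is 0 by \<open>H\<close>.\<close>
  have "(\<Sum>u\<in>U ` space M. \<Sum>v\<in>V ` space M. t u v) = 0"
    using H by (simp add: t_def sum_subtractf sum.distrib flip: sum_distrib_left)
      (simp add: q r p1 qr1 shannon_entropy_Pair[OF U V] shannon_entropy_point_prob[OF U]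
        shannon_entropy_point_prob[OF V] sum_point_prob[OF U] sum_point_prob[OF V])
  then have "t u v = 0"
    using fin uv t by (auto simp: sum_nonneg_eq_0_iff sum_nonneg)
  then show ?thesis using t by blast
qed

end

section \<open>Entropy equalities read as statements about events\<close>

lemma subvector_eq_iff: "subvector X A \<omega> = subvector X A \<omega>' \<longleftrightarrow> (\<forall>j\<in>A. X j \<omega> = X j \<omega>')"
  by (auto simp: subvector_def fun_eq_iff restrict_def)

text \<open>The fibre of \<open>subvector X A\<close> through \<omega>. Indexing fibres by outcomes
  instead of values turns joint events into intersections and hides the extensional
  functions.\<close>

definition agree :: "'w measure \<Rightarrow> (nat \<Rightarrow> 'w \<Rightarrow> 'v) \<Rightarrow> nat set \<Rightarrow> 'w \<Rightarrow> 'w set" where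
  "agree M X A \<omega> = {\<omega>' \<in> space M. \<forall>j\<in>A. X j \<omega>' = X j \<omega>}"

lemma point_prob_subvector:
  "point_prob M (subvector X A) (subvector X A \<omega>) = measure M (agree M X A \<omega>)"
  unfolding point_prob_def agree_def
  by (rule arg_cong[of _ _ "measure M"]) (auto simp: subvector_eq_iff)

lemma point_prob_subvector_Pair:
  "point_prob M (\<lambda>\<omega>. (subvector X A \<omega>, subvector X B \<omega>)) (subvector X A \<omega>, subvector X B \<omega>')
    = measure M (agree M X A \<omega> \<inter> agree M X B \<omega>')"
  unfolding point_prob_def agree_def
  by (rule arg_cong[of _ _ "measure M"]) (auto simp: subvector_eq_iff)

lemma agree_Un: "agree M X A \<omega> \<inter> agree M X B \<omega> = agree M X (A \<union> B) \<omega>"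
  by (auto simp: agree_def)

text \<open>The pair of restrictions to \<open>A\<close> and \<open>B\<close> is an injective
  function of the subvector on the union, also when \<open>A\<close> and \<open>B\<close>
  overlap.\<close>

lemma shannon_entropy_subvector_Pair:
  assumes "prob_space M" "simple_function M (subvector X (A \<union> B))"
  shows "shannon_entropy M (\<lambda>\<omega>. (subvector X A \<omega>, subvector X B \<omega>))
    = shannon_entropy M (subvector X (A \<union> B))"
proof -
  define f where "f z = (restrict z A, restrict z B)" for z :: "nat \<Rightarrow> 'b"
  have "f (subvector X (A \<union> B) \<omega>) = (subvector X A \<omega>, subvector X B \<omega>)" for \<omega>
    by (auto simp: f_def subvector_def fun_eq_iff restrict_def)
  moreover from this have "inj_on f (subvector X (A \<union> B) ` space M)"
    by (auto simp: inj_on_def subvector_eq_iff)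
  ultimately show ?thesis
    using prob_space.shannon_entropy_inj[OF assms, of f] by simp
qed

text \<open>Equal entropies mean that the smaller subvector determines the larger one up to null
  events, so a non-null fibre of the larger one fills the fibre of the smaller one up to a null
  set.\<close>

lemma has_entropy_function_determined:
  assumes E: "has_entropy_function M X h" and AB: "A \<subseteq> B" "B \<subseteq> N4" and h: "h B = h A"
    and \<omega>: "\<omega> \<in> space M" "measure M (agree M X B \<omega>) \<noteq> 0"
  shows "measure M (agree M X B \<omega>) = measure M (agree M X A \<omega>)"
proof -
  interpret prob_space M using E by (simp add: has_entropy_function_def)
  have s: "simple_function M (subvector X C)" if "C \<subseteq> N4" for C
    using E that by (simp add: has_entropy_function_def simple_function_subvector)
  have sA: "simple_function M (subvector X A)" and sB: "simple_function M (subvector X B)"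
    using s AB by auto
  have [simp]: "A \<union> B = B" using AB by blast
  have "shannon_entropy M (\<lambda>\<omega>. (subvector X A \<omega>, subvector X B \<omega>)) = shannon_entropy M (subvector X A)"
    using shannon_entropy_subvector_Pair[OF prob_space_axioms, of X A B] sB h E AB
    by (simp add: has_entropy_function_def)
  from point_prob_Pair_determined[OF sA sB this, of "subvector X A \<omega>" "subvector X B \<omega>"] \<omega>
  show ?thesis by (simp add: point_prob_subvector_Pair point_prob_subvector agree_Un)
qed

text \<open>Two separate outcomes are allowed so that a value of one subvector can be combined with
  an unrelated value of the other.\<close>

lemma has_entropy_function_indep:
  assumes E: "has_entropy_function M X h" and AB: "A \<subseteq> N4" "B \<subseteq> N4" and h: "h (A \<union> B) = h A + h B"
    and \<omega>: "\<omega> \<in> space M" "\<omega>' \<in> space M"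
  shows "measure M (agree M X A \<omega> \<inter> agree M X B \<omega>')
    = measure M (agree M X A \<omega>) * measure M (agree M X B \<omega>')"
proof -
  interpret prob_space M using E by (simp add: has_entropy_function_def)
  have s: "simple_function M (subvector X C)" if "C \<subseteq> N4" for C
    using E that by (simp add: has_entropy_function_def simple_function_subvector)
  have sA: "simple_function M (subvector X A)" and sB: "simple_function M (subvector X B)"
    using s AB by auto
  have "shannon_entropy M (\<lambda>\<omega>. (subvector X A \<omega>, subvector X B \<omega>))
      = shannon_entropy M (subvector X A) + shannon_entropy M (subvector X B)"
    using shannon_entropy_subvector_Pair[OF prob_space_axioms s, of A B] h E AB
    by (simp add: has_entropy_function_def)
  from point_prob_Pair_indep[OF sA sB this, of "subvector X A \<omega>" "subvector X B \<omega>'"] \<omega>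
  show ?thesis by (simp add: point_prob_subvector_Pair point_prob_subvector)
qed

text \<open>Finitely many fibres of the full vector cover \<open>S\<close>. If all those through
  points of \<open>S\<close> were null, \<open>S\<close> would be null too.\<close>

lemma has_entropy_function_pos_outcome:
  assumes E: "has_entropy_function M X h" and S: "measure M S \<noteq> 0"
  obtains \<omega> where "\<omega> \<in> S" "\<omega> \<in> space M" "measure M (agree M X N4 \<omega>) \<noteq> 0"
proof -
  interpret prob_space M using E by (simp add: has_entropy_function_def)
  have s: "simple_function M (subvector X N4)"
    using E by (simp add: has_entropy_function_def simple_function_subvector)
  \<comment> \<open>Non-measurable sets have \<open>measure\<close> 0 by convention, so
    measurability comes for free.\<close>
  have SM: "S \<in> sets M" using S measure_notin_sets by blast
  have "\<exists>\<omega>\<in>S. measure M (agree M X N4 \<omega>) \<noteq> 0"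
  proof (rule ccontr)
    assume 0: "\<not> ?thesis"
    define F where "F y = subvector X N4 -` {y} \<inter> space M" for y
    let ?Y = "subvector X N4 ` S"
    have fin: "finite ?Y"
      using s sets.sets_into_space[OF SM]
      by (meson finite_subset image_mono simple_function_def)
    have FM: "F y \<in> sets M" for y unfolding F_def using s by (rule simple_functionD(2))
    have "measure M (F y) = 0" if "y \<in> ?Y" for y
      using that 0 point_prob_subvector[of M X N4] by (auto simp: F_def point_prob_def)
    then have "measure M (\<Union>y\<in>?Y. F y) \<le> 0"
      using finite_measure_subadditive_finite[OF fin, of F] FM by (simp add: image_subset_iff)
    moreover have "measure M S \<le> measure M (\<Union>y\<in>?Y. F y)"
    proof (rule finite_measure_mono)
      show "S \<subseteq> (\<Union>y\<in>?Y. F y)" using sets.sets_into_space[OF SM] by (auto simp: F_def)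
      show "(\<Union>y\<in>?Y. F y) \<in> sets M" using fin FM by (intro sets.finite_UN) auto
    qed
    ultimately show False using S measure_nonneg[of M S] by linarith
  qed
  then show ?thesis using that sets.sets_into_space[OF SM] by blast
qed

section \<open>Entropic multiples have a logarithmic factor\<close>

lemma rank_U35_entropic_imp_log:
  assumes i: "i \<in> N4" and "entropic (\<lambda>A. a * real (rank_U35 i A))"
  shows "\<exists>v::int. v \<ge> 1 \<and> a = log 2 (real_of_int v)"
proof -
  define h where "h A = a * real (rank_U35 i A)" for A
  obtain M :: "nat measure" and X :: "nat \<Rightarrow> nat \<Rightarrow> nat" where E: "has_entropy_function M X h"
    using assms(2) unfolding entropic_def h_def by blast
  interpret prob_space M using E by (simp add: has_entropy_function_def)
  obtain j k where jk: "j \<in> N4" "k \<in> N4" "j \<noteq> i" "k \<noteq> i" "j \<noteq> k"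
    using i unfolding N4_def by force
  define q where "q A \<omega> = measure M (agree M X A \<omega>)" for A \<omega>
  have hN: "h N4 = 3 * a" using i by (simp add: h_def rank_U35_def N4_def)
  \<comment> \<open>The pair \<open>{i, m}\<close> already has the full rank 3, and this is the sum
    of the ranks 2 of \<open>{i}\<close> and 1 of \<open>{m}\<close>: the pair determines
    everything, and its members are independent.\<close>
  have qi: "q N4 \<omega> = q {i} \<omega> * q {m} \<omega>"
    if "\<omega> \<in> space M" "q N4 \<omega> \<noteq> 0" "m \<in> N4" "m \<noteq> i" for m \<omega>
  proof -
    have "h N4 = h {i, m}" using hN that by (simp add: h_def rank_U35_def)
    then have "q N4 \<omega> = q {i, m} \<omega>"
      unfolding q_def using that i
      by (intro has_entropy_function_determined[OF E]) (auto simp: q_def)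
    moreover have "h ({i} \<union> {m}) = h {i} + h {m}" using that by (simp add: h_def rank_U35_def)
    then have "q {i, m} \<omega> = q {i} \<omega> * q {m} \<omega>"
      using has_entropy_function_indep[OF E, of "{i}" "{m}" \<omega> \<omega>] that i
      by (simp add: q_def agree_Un insert_commute)
    ultimately show ?thesis by simp
  qed
  \<comment> \<open>Independence of \<open>X j\<close> and \<open>X k\<close> yields an outcome
    \<eta> with the \<open>j\<close>-value of \<omega> and the \<open>k\<close>-value of \<omega>'.
    At \<eta> the common factor \<open>q {i} \<eta>\<close> in the two instances of
    \<open>qi\<close> cancels.\<close>
  have q_const: "q {j} \<omega> = q {k} \<omega>'"
    if \<omega>: "\<omega> \<in> space M" "\<omega>' \<in> space M" "q {j} \<omega> \<noteq> 0" "q {k} \<omega>' \<noteq> 0" for \<omega> \<omega>'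
  proof -
    have "h ({j} \<union> {k}) = h {j} + h {k}" using jk by (simp add: h_def rank_U35_def)
    then have "measure M (agree M X {j} \<omega> \<inter> agree M X {k} \<omega>') = q {j} \<omega> * q {k} \<omega>'"
      using has_entropy_function_indep[OF E, of "{j}" "{k}" \<omega> \<omega>'] \<omega> jk by (simp add: q_def)
    then have "measure M (agree M X {j} \<omega> \<inter> agree M X {k} \<omega>') \<noteq> 0" using \<omega> by simp
    then obtain \<eta> where \<eta>: "\<eta> \<in> agree M X {j} \<omega>" "\<eta> \<in> agree M X {k} \<omega>'" "\<eta> \<in> space M" "q N4 \<eta> \<noteq> 0"
      using has_entropy_function_pos_outcome[OF E] by (auto simp: q_def)
    have "q {j} \<eta> = q {k} \<eta>"
      using qi[OF \<eta>(3,4) jk(1,3)] qi[OF \<eta>(3,4) jk(2,4)] \<eta>(4) by auto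
    moreover have "q {j} \<eta> = q {j} \<omega>" "q {k} \<eta> = q {k} \<omega>'"
      using \<eta> by (auto simp: q_def agree_def)
    ultimately show ?thesis by simp
  qed
  have "measure M (space M) \<noteq> 0" by (simp add: prob_space)
  then obtain \<omega>0 where \<omega>0: "\<omega>0 \<in> space M" "q N4 \<omega>0 \<noteq> 0"
    using has_entropy_function_pos_outcome[OF E] by (auto simp: q_def)
  \<comment> \<open>Comparison with this one fixed value of \<open>X k\<close> makes all positive
    point probabilities of \<open>X j\<close> equal.\<close>
  define c where "c = q {k} \<omega>0"
  have c0: "c \<noteq> 0" using qi[OF \<omega>0 jk(2,4)] \<omega>0(2) by (auto simp: c_def)
  let ?Y = "subvector X {j}"
  have s: "simple_function M ?Y"
    using E jk by (simp add: has_entropy_function_def simple_function_subvector)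
  have pc: "point_prob M ?Y y = c" if "y \<in> ?Y ` space M" "point_prob M ?Y y \<noteq> 0" for y
    using that q_const[OF _ \<omega>0(1)] c0 by (auto simp: point_prob_subvector q_def c_def)
  \<comment> \<open>The support of \<open>X j\<close>; its cardinality is the integer
    sought.\<close>
  define S where "S = {y \<in> ?Y ` space M. point_prob M ?Y y \<noteq> 0}"
  have fin: "finite (?Y ` space M)" using s by (simp add: simple_function_def)
  have "1 = (\<Sum>y\<in>S. point_prob M ?Y y)"
    unfolding sum_point_prob[OF s, symmetric] S_def
    by (rule sum.mono_neutral_right) (use fin in auto)
  also have "\<dots> = (\<Sum>y\<in>S. c)" by (rule sum.cong) (use pc in \<open>auto simp: S_def\<close>)
  also have "\<dots> = real (card S) * c" by simp
  finally have c: "real (card S) * c = 1" by simp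
  have "a = h {j}" using jk by (simp add: h_def rank_U35_def)
  also have "\<dots> = shannon_entropy M ?Y" using E jk by (simp add: has_entropy_function_def)
  also have "\<dots> = - log 2 c" using shannon_entropy_constant_point_prob[OF s pc] by simp
  also have "c = 1 / real (card S)"
    using c by (metis mult_zero_left nonzero_eq_divide_eq mult.commute zero_neq_one)
  also have "- log 2 (1 / real (card S)) = log 2 (real_of_int (int (card S)))"
    using c by (simp add: log_recip)
  finally have "a = log 2 (real_of_int (int (card S)))" .
  moreover have "int (card S) \<ge> 1" using c by (cases "card S") auto
  ultimately show ?thesis by blast
qed

section \<open>Construction from three uniform residues and their differences\<close>

lemma mod_diff_inj:
  fixes x x' z z' v :: int
  assumes "(x - z) mod v = (x' - z') mod v" "x mod v = x' mod v"
  shows "z mod v = z' mod v"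
proof -
  have "(x - (x - z)) mod v = (x' - (x' - z')) mod v"
    using assms mod_diff_cong by blast
  then show ?thesis by simp
qed

text \<open>Only the coordinates in \<open>J - A\<close> are free; the inverse of restricting to
  them refills \<open>A\<close> from \<omega>.\<close>

lemma card_PiE_agree:
  assumes "finite J" "A \<subseteq> J" "\<omega> \<in> (\<Pi>\<^sub>E j\<in>J. S)"
  shows "card {\<omega>' \<in> (\<Pi>\<^sub>E j\<in>J. S). \<forall>j\<in>A. \<omega>' j = \<omega> j} = card S ^ (card J - card A)"
proof -
  have "bij_betw (\<lambda>\<omega>'. restrict \<omega>' (J - A))
    {\<omega>' \<in> (\<Pi>\<^sub>E j\<in>J. S). \<forall>j\<in>A. \<omega>' j = \<omega> j} (\<Pi>\<^sub>E j\<in>J - A. S)"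
  proof (rule bij_betw_byWitness[where f' = "\<lambda>\<eta> j. if j \<in> A then \<omega> j else \<eta> j"], goal_cases)
    case 1
    then show ?case by (auto simp: fun_eq_iff PiE_iff extensional_def)
  next
    case 2
    then show ?case by (auto simp: fun_eq_iff PiE_iff extensional_def)
  next
    case 3
    then show ?case by (auto simp: PiE_iff split: if_splits)
  next
    case 4
    have "(\<lambda>j. if j \<in> A then \<omega> j else \<eta> j) \<in> (\<Pi>\<^sub>E j\<in>J. S)" if "\<eta> \<in> (\<Pi>\<^sub>E j\<in>J - A. S)" for \<eta>
    proof (rule PiE_I)
      show "(if j \<in> A then \<omega> j else \<eta> j) \<in> S" if "j \<in> J" for j
        using that assms(3) \<open>\<eta> \<in> _\<close> by (simp add: PiE_iff)
      show "(if j \<in> A then \<omega> j else \<eta> j) = undefined" if "j \<notin> J" for j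
        using that assms(2) PiE_arb[OF \<open>\<eta> \<in> _\<close>] by auto
    qed
    then show ?case by auto
  qed
  then have "card {\<omega>' \<in> (\<Pi>\<^sub>E j\<in>J. S). \<forall>j\<in>A. \<omega>' j = \<omega> j} = card (\<Pi>\<^sub>E j\<in>J - A. S)"
    by (rule bij_betw_same_card)
  also have "\<dots> = card S ^ (card J - card A)"
    using assms by (simp add: card_PiE card_Diff_subset finite_subset)
  finally show ?thesis .
qed

text \<open>The functions with the same differences as \<omega> are its translates by a constant
  modulo \<open>v\<close>. The value at \<open>j0\<close> parametrises them.\<close>

lemma card_PiE_translates:
  fixes v :: int
  assumes "0 < v" "j0 \<in> J" "\<omega> \<in> (\<Pi>\<^sub>E j\<in>J. {0..<v})"
  shows "card {\<omega>' \<in> (\<Pi>\<^sub>E j\<in>J. {0..<v}). \<forall>j\<in>J. (\<omega>' j - \<omega>' j0) mod v = (\<omega> j - \<omega> j0) mod v} = nat v"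
proof -
  have "bij_betw (\<lambda>\<omega>'. \<omega>' j0)
    {\<omega>' \<in> (\<Pi>\<^sub>E j\<in>J. {0..<v}). \<forall>j\<in>J. (\<omega>' j - \<omega>' j0) mod v = (\<omega> j - \<omega> j0) mod v} {0..<v}"
  proof (rule bij_betw_byWitness[where f' = "\<lambda>x. \<lambda>j\<in>J. (\<omega> j - \<omega> j0 + x) mod v"], goal_cases)
    case 1
    have "(\<omega> j - \<omega> j0 + \<omega>' j0) mod v = \<omega>' j"
      if "\<omega>' \<in> (\<Pi>\<^sub>E j\<in>J. {0..<v})" "(\<omega>' j - \<omega>' j0) mod v = (\<omega> j - \<omega> j0) mod v" "j \<in> J" for \<omega>' j
    proof -
      have "(\<omega> j - \<omega> j0 + \<omega>' j0) mod v = (\<omega>' j - \<omega>' j0 + \<omega>' j0) mod v"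
        using that(2) by (metis mod_add_left_eq)
      then show ?thesis using that by (auto simp: PiE_iff)
    qed
    then show ?case by (auto simp: fun_eq_iff PiE_iff extensional_def)
  next
    case 2
    then show ?case using assms by auto
  next
    case 3
    then show ?case using assms by (auto simp: PiE_iff)
  next
    case 4
    then show ?case using assms by (auto simp: mod_simps)
  qed
  then have "card {\<omega>' \<in> (\<Pi>\<^sub>E j\<in>J. {0..<v}). \<forall>j\<in>J. (\<omega>' j - \<omega>' j0) mod v = (\<omega> j - \<omega> j0) mod v}
      = card {0..<v}" by (rule bij_betw_same_card)
  then show ?thesis by simp
qed

text \<open>The differences leave only a common translation open, and one known coordinate fixes it:
  \<open>m\<close> gives the value at \<open>j0\<close>, which gives all others.\<close>

lemma PiE_translates_eq:
  fixes v :: int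
  assumes "j0 \<in> J" "\<omega> \<in> (\<Pi>\<^sub>E j\<in>J. {0..<v})" "\<omega>' \<in> (\<Pi>\<^sub>E j\<in>J. {0..<v})"
    and d: "\<And>j. j \<in> J \<Longrightarrow> (\<omega>' j - \<omega>' j0) mod v = (\<omega> j - \<omega> j0) mod v"
    and m: "m \<in> J" "\<omega>' m = \<omega> m"
  shows "\<omega>' = \<omega>"
proof (rule PiE_ext[OF assms(3,2)])
  fix j assume j: "j \<in> J"
  have "\<omega>' j0 mod v = \<omega> j0 mod v" using mod_diff_inj[OF d[OF m(1)]] m(2) by simp
  then have "(\<omega>' j - \<omega>' j0 + \<omega>' j0) mod v = (\<omega> j - \<omega> j0 + \<omega> j0) mod v"
    using d[OF j] by (intro mod_add_cong)
  then show "\<omega>' j = \<omega> j" using assms(2,3) j by (auto simp: PiE_iff)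
qed

lemma log_imp_rank_U35_entropic:
  assumes i: "i \<in> N4" and v: "v \<ge> 1" and a: "a = log 2 (real_of_int v)"
  shows "entropic (\<lambda>A. a * real (rank_U35 i A))"
proof -
  define J where "J = N4 - {i}"
  have J: "finite J" "card J = 3" "i \<notin> J" "N4 = insert i J"
    using i by (auto simp: J_def N4_def)
  \<comment> \<open>A base coordinate: differences to \<open>j0\<close> determine all pairwise
    differences.\<close>
  then obtain j0 where j0: "j0 \<in> J" by (metis card.empty all_not_in_conv zero_neq_numeral)
  define \<Omega> where "\<Omega> = (\<Pi>\<^sub>E j\<in>J. {0..<v})"
  have fin: "finite \<Omega>" unfolding \<Omega>_def using J by (intro finite_PiE) auto
  have card: "card \<Omega> = nat v ^ 3" using J by (simp add: \<Omega>_def card_PiE)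
  have ne: "\<Omega> \<noteq> {}" using card v by auto
  define M where "M = uniform_count_measure \<Omega>"
  \<comment> \<open>All variables must have the same value type, so \<open>X j\<close> is a constant function for \<open>j \<noteq> i\<close>.
    The restriction to \<open>J\<close> in \<open>X i\<close> matters: a difference \<open>undefined - \<omega> j0\<close> would reveal \<open>\<omega> j0\<close>.\<close>
  define X where "X j \<omega> = (if j = i then (\<lambda>m\<in>J. (\<omega> m - \<omega> j0) mod v) else (\<lambda>_. \<omega> j))"
    for j :: nat and \<omega> :: "nat \<Rightarrow> int"
  interpret prob_space M unfolding M_def using fin ne by (rule prob_space_uniform_count_measure)
  have sp [simp]: "space M = \<Omega>" "sets M = Pow \<Omega>"
    by (simp_all add: M_def space_uniform_count_measure sets_uniform_count_measure)
  have X: "\<forall>j\<in>N4. simple_function M (X j)" using fin by (simp add: simple_function_def)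
  have Xi: "X i \<omega>' = X i \<omega> \<longleftrightarrow> (\<forall>j\<in>J. (\<omega>' j - \<omega>' j0) mod v = (\<omega> j - \<omega> j0) mod v)" for \<omega> \<omega>'
    by (auto simp: X_def fun_eq_iff restrict_def)
  have XJ: "X j \<omega>' = X j \<omega> \<longleftrightarrow> \<omega>' j = \<omega> j" if "j \<in> J" for j \<omega> \<omega>'
    using that J by (auto simp: X_def fun_eq_iff)
  \<comment> \<open>All fibres of a subvector have the same size, so each subvector is uniform on
    its range. The three cases are no difference vector (rank \<open>card A\<close>), the difference
    vector alone (rank 2, fibre of translates), and the difference vector with a coordinate (rank 3,
    one point).\<close>
  have fibre: "card (agree M X A \<omega>) = nat v ^ (3 - rank_U35 i A)"
    if A: "A \<subseteq> N4" and \<omega>: "\<omega> \<in> \<Omega>" for A \<omega>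
  proof -
    consider "i \<notin> A" | "A = {i}" | m where "i \<in> A" "m \<in> A" "m \<in> J"
      using A J by blast
    then show ?thesis
    proof cases
      case 1
      then have AJ: "A \<subseteq> J" using A J by auto
      then have "agree M X A \<omega> = {\<omega>' \<in> \<Omega>. \<forall>j\<in>A. \<omega>' j = \<omega> j}"
        using XJ by (auto simp: agree_def subset_iff)
      then show ?thesis
        using card_PiE_agree[OF J(1) AJ \<omega>[unfolded \<Omega>_def]] J 1 by (simp add: \<Omega>_def rank_U35_def)
    next
      case 2
      then have "agree M X A \<omega> = {\<omega>' \<in> \<Omega>. \<forall>j\<in>J. (\<omega>' j - \<omega>' j0) mod v = (\<omega> j - \<omega> j0) mod v}"
        using Xi by (simp add: agree_def)
      then show ?thesis
        using card_PiE_translates[OF _ j0 \<omega>[unfolded \<Omega>_def]] v 2 by (simp add: \<Omega>_def rank_U35_def)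
    next
      case 3
      have "\<omega>' = \<omega>" if "\<omega>' \<in> agree M X A \<omega>" for \<omega>'
      proof -
        have "\<omega>' \<in> \<Omega>" "X i \<omega>' = X i \<omega>" "X m \<omega>' = X m \<omega>" using that 3 by (auto simp: agree_def)
        then show ?thesis
          using PiE_translates_eq[OF j0 \<omega>[unfolded \<Omega>_def], of \<omega>' m] 3(3) Xi XJ
          by (simp add: \<Omega>_def)
      qed
      then have "agree M X A \<omega> = {\<omega>}" using \<omega> by (auto simp: agree_def)
      moreover have "card {i, m} \<le> card A"
        using 3 A J by (intro card_mono) (auto intro: finite_subset)
      then have "2 \<le> card A" using 3 J by (auto simp: card_insert_if split: if_splits)
      then have "rank_U35 i A = 3" using 3 by (simp add: rank_U35_def)
      ultimately show ?thesis by simp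
    qed
  qed
  have "a * real (rank_U35 i A) = shannon_entropy M (subvector X A)" if A: "A \<subseteq> N4" for A
  proof -
    define c where "c = real_of_int v ^ (3 - rank_U35 i A) / real_of_int v ^ 3"
    have "card A \<le> 3" if "i \<notin> A"
      using A that J card_mono[of J A] by (metis subset_insert)
    \<comment> \<open>This bound makes the natural subtraction \<open>3 - rank_U35 i A\<close> a
      true one, so that the quotient \<open>c\<close> simplifies.\<close>
    then have r: "rank_U35 i A \<le> 3" by (simp add: rank_U35_def)
    have "point_prob M (subvector X A) y = c" if "y \<in> subvector X A ` space M" for y
    proof -
      obtain \<omega> where \<omega>: "\<omega> \<in> \<Omega>" "y = subvector X A \<omega>" using \<open>y \<in> _\<close> by auto
      have "agree M X A \<omega> \<subseteq> \<Omega>" by (auto simp: agree_def)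
      then have "measure M (agree M X A \<omega>) = card (agree M X A \<omega>) / card \<Omega>"
        unfolding M_def by (rule measure_uniform_count_measure[OF fin])
      then show ?thesis
        using fibre[OF A \<omega>(1)] card v by (simp add: \<omega> point_prob_subvector c_def)
    qed
    then have "shannon_entropy M (subvector X A) = - log 2 c"
      by (intro shannon_entropy_constant_point_prob simple_function_subvector[OF X A])
    also have "c = 1 / real_of_int v ^ rank_U35 i A"
      using r v by (simp add: c_def power_diff)
    also have "- log 2 (1 / real_of_int v ^ rank_U35 i A) = a * real (rank_U35 i A)"
      using v by (simp add: a log_recip log_nat_power)
    finally show ?thesis by simp
  qed
  then have "has_entropy_function M X (\<lambda>A. a * real (rank_U35 i A))"
    using X prob_space_axioms by (simp add: has_entropy_function_def)
  \<comment> \<open>The outcomes and the values of \<open>X\<close> here are functions, and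
    \<open>entropic\<close> asks for natural numbers; this transfers the example.\<close>
  then show ?thesis by (rule has_entropy_function_imp_entropic)
qed

theorem mainTheorem2:
  fixes i :: nat and a :: real
  assumes "i \<in> N4" and "a \<ge> 0"
  shows "entropic (\<lambda>A. a * real (rank_U35 i A)) \<longleftrightarrow>
    (\<exists>v::int. v \<ge> 1 \<and> a = log 2 (real_of_int v))"
  using rank_U35_entropic_imp_log[OF assms(1)] log_imp_rank_U35_entropic[OF assms(1)] by blast

end
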